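(* Let $n\ge1$ and let $(a_1,a_2,a_3,a_4)\in\mathbb H(\mathbb Z_{2^n})$. Each coordinate $a_i$ is either a unit of $\mathbb Z_{2^n}$ (an odd residue) or a zero-divisor of $\mathbb Z_{2^n}$ (an even residue, including $0$). Consider the five cases: (i) all four coordinates are zero-divisors of $\mathbb Z_{2^n}$; (ii) all four coordinates are units of $\mathbb Z_{2^n}$; (iii) exactly two coordinates are units and two are zero-divisors; (iv) exactly three coordinates are units and one is a zero-divisor; (v) exactly one coordinate is a unit and three are zero-divisors. Every element of $\mathbb H(\mathbb Z_{2^n})$ falls into exactly one of these cases. The elements in cases (i), (ii) and (iii) are zero-divisors of $\mathbb H(\mathbb Z_{2^n})$ (here $(0,0,0,0)$ is counted in case (i)). The elements in cases (iv) and (v) are units of $\mathbb H(\mathbb Z_{2^n})$.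
   Context: $\mathbb H(\mathbb Z_{2^n})$ is the ring of Hamilton quaternions over $\mathbb Z_{2^n}$. Its elements are $a_1+a_2i+a_3j+a_4k$ with $a_i\in\mathbb Z_{2^n}$, written $(a_1,a_2,a_3,a_4)$. Addition is coordinatewise, and multiplication is determined by distributivity, scalars commuting with $i,j,k$, and $i^2=j^2=k^2=-1$, $ij=-ji=k$, $jk=-kj=i$, $ki=-ik=j$. *)

theory Defs
  imports "HOL-Number_Theory.Residues"
begin

type_synonym 'a quat = "'a \<times> 'a \<times> 'a \<times> 'a"

text \<open>
  Hamilton quaternions over a ring \<open>R\<close>: the tuple \<open>(a\<^sub>1, a\<^sub>2, a\<^sub>3, a\<^sub>4)\<close> stands for
  \<open>a\<^sub>1 + a\<^sub>2 i + a\<^sub>3 j + a\<^sub>4 k\<close>.  The product is the bilinear extension of the Hamilton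
  relations, see \<open>quaternion_ring_relations\<close>.
\<close>

fun quat_add :: "('a, 'm) ring_scheme \<Rightarrow> 'a quat \<Rightarrow> 'a quat \<Rightarrow> 'a quat" where
  "quat_add R (a1, a2, a3, a4) (b1, b2, b3, b4) =
     (a1 \<oplus>\<^bsub>R\<^esub> b1, a2 \<oplus>\<^bsub>R\<^esub> b2, a3 \<oplus>\<^bsub>R\<^esub> b3, a4 \<oplus>\<^bsub>R\<^esub> b4)"

fun quat_mult :: "('a, 'm) ring_scheme \<Rightarrow> 'a quat \<Rightarrow> 'a quat \<Rightarrow> 'a quat" where
  "quat_mult R (a1, a2, a3, a4) (b1, b2, b3, b4) =
     (a1 \<otimes>\<^bsub>R\<^esub> b1 \<ominus>\<^bsub>R\<^esub> a2 \<otimes>\<^bsub>R\<^esub> b2 \<ominus>\<^bsub>R\<^esub> a3 \<otimes>\<^bsub>R\<^esub> b3 \<ominus>\<^bsub>R\<^esub> a4 \<otimes>\<^bsub>R\<^esub> b4,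
      a1 \<otimes>\<^bsub>R\<^esub> b2 \<oplus>\<^bsub>R\<^esub> a2 \<otimes>\<^bsub>R\<^esub> b1 \<oplus>\<^bsub>R\<^esub> a3 \<otimes>\<^bsub>R\<^esub> b4 \<ominus>\<^bsub>R\<^esub> a4 \<otimes>\<^bsub>R\<^esub> b3,
      a1 \<otimes>\<^bsub>R\<^esub> b3 \<ominus>\<^bsub>R\<^esub> a2 \<otimes>\<^bsub>R\<^esub> b4 \<oplus>\<^bsub>R\<^esub> a3 \<otimes>\<^bsub>R\<^esub> b1 \<oplus>\<^bsub>R\<^esub> a4 \<otimes>\<^bsub>R\<^esub> b2,
      a1 \<otimes>\<^bsub>R\<^esub> b4 \<oplus>\<^bsub>R\<^esub> a2 \<otimes>\<^bsub>R\<^esub> b3 \<ominus>\<^bsub>R\<^esub> a3 \<otimes>\<^bsub>R\<^esub> b2 \<oplus>\<^bsub>R\<^esub> a4 \<otimes>\<^bsub>R\<^esub> b1)"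

definition quaternion_ring :: "('a, 'm) ring_scheme \<Rightarrow> 'a quat ring" where
  "quaternion_ring R =
     \<lparr>carrier = carrier R \<times> carrier R \<times> carrier R \<times> carrier R,
      monoid.mult = quat_mult R,
      one = (\<one>\<^bsub>R\<^esub>, \<zero>\<^bsub>R\<^esub>, \<zero>\<^bsub>R\<^esub>, \<zero>\<^bsub>R\<^esub>),
      zero = (\<zero>\<^bsub>R\<^esub>, \<zero>\<^bsub>R\<^esub>, \<zero>\<^bsub>R\<^esub>, \<zero>\<^bsub>R\<^esub>),
      add = quat_add R\<rparr>"

lemma quaternion_ring_simps:
  "carrier (quaternion_ring R) = carrier R \<times> carrier R \<times> carrier R \<times> carrier R"
  "x \<otimes>\<^bsub>quaternion_ring R\<^esub> y = quat_mult R x y"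
  "x \<oplus>\<^bsub>quaternion_ring R\<^esub> y = quat_add R x y"
  "\<one>\<^bsub>quaternion_ring R\<^esub> = (\<one>\<^bsub>R\<^esub>, \<zero>\<^bsub>R\<^esub>, \<zero>\<^bsub>R\<^esub>, \<zero>\<^bsub>R\<^esub>)"
  "\<zero>\<^bsub>quaternion_ring R\<^esub> = (\<zero>\<^bsub>R\<^esub>, \<zero>\<^bsub>R\<^esub>, \<zero>\<^bsub>R\<^esub>, \<zero>\<^bsub>R\<^esub>)"
  by (simp_all add: quaternion_ring_def)

lemma (in cring) quat_distr:
  assumes "x \<in> carrier (quaternion_ring R)" "y \<in> carrier (quaternion_ring R)"
    "z \<in> carrier (quaternion_ring R)"
  shows "quat_mult R (quat_add R x y) z = quat_add R (quat_mult R x z) (quat_mult R y z)"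
    "quat_mult R z (quat_add R x y) = quat_add R (quat_mult R z x) (quat_mult R z y)"
  using assms by (auto simp: quaternion_ring_simps minus_eq
      l_distr r_distr l_minus r_minus minus_add a_ac)

lemma (in cring) quat_assoc:
  assumes "x \<in> carrier (quaternion_ring R)" "y \<in> carrier (quaternion_ring R)"
    "z \<in> carrier (quaternion_ring R)"
  shows "quat_mult R (quat_mult R x y) z = quat_mult R x (quat_mult R y z)"
proof -
  obtain a1 a2 a3 a4 b1 b2 b3 b4 c1 c2 c3 c4 where
    e: "x = (a1,a2,a3,a4)" "y = (b1,b2,b3,b4)" "z = (c1,c2,c3,c4)" by (metis prod_cases4)
  have m: "a1 \<in> carrier R" "a2 \<in> carrier R" "a3 \<in> carrier R" "a4 \<in> carrier R"
       "b1 \<in> carrier R" "b2 \<in> carrier R" "b3 \<in> carrier R" "b4 \<in> carrier R"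
       "c1 \<in> carrier R" "c2 \<in> carrier R" "c3 \<in> carrier R" "c4 \<in> carrier R"
    using assms by (auto simp: e quaternion_ring_simps)
  show ?thesis
    unfolding e quat_mult.simps prod.inject using m
    by (intro conjI)
       (simp_all add: minus_eq l_distr r_distr l_minus r_minus minus_add m_assoc a_ac)
qed
lemma (in cring) quaternion_ring_is_ring: "ring (quaternion_ring R)"
proof (rule ringI)
  show "abelian_group (quaternion_ring R)"
  proof (rule abelian_groupI)
    fix x assume "x \<in> carrier (quaternion_ring R)"
    then obtain a b c d where x: "x = (a, b, c, d)"
      and "a \<in> carrier R" "b \<in> carrier R" "c \<in> carrier R" "d \<in> carrier R"
      by (auto simp: quaternion_ring_simps)
    then show "\<exists>y\<in>carrier (quaternion_ring R).
        y \<oplus>\<^bsub>quaternion_ring R\<^esub> x = \<zero>\<^bsub>quaternion_ring R\<^esub>"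
      by (intro bexI[of _ "(\<ominus> a, \<ominus> b, \<ominus> c, \<ominus> d)"])
         (auto simp: quaternion_ring_simps l_neg)
  qed (auto simp: quaternion_ring_simps a_ac)
  show "Group.monoid (quaternion_ring R)"
  proof (rule monoidI)
    fix x y z
    assume "x \<in> carrier (quaternion_ring R)" "y \<in> carrier (quaternion_ring R)"
      "z \<in> carrier (quaternion_ring R)"
    then show "x \<otimes>\<^bsub>quaternion_ring R\<^esub> y \<otimes>\<^bsub>quaternion_ring R\<^esub> z =
        x \<otimes>\<^bsub>quaternion_ring R\<^esub> (y \<otimes>\<^bsub>quaternion_ring R\<^esub> z)"
      using quat_assoc by (simp add: quaternion_ring_simps)
  qed (auto simp: quaternion_ring_simps minus_eq)
next
  fix x y z
  assume "x \<in> carrier (quaternion_ring R)" "y \<in> carrier (quaternion_ring R)"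
    "z \<in> carrier (quaternion_ring R)"
  then show "(x \<oplus>\<^bsub>quaternion_ring R\<^esub> y) \<otimes>\<^bsub>quaternion_ring R\<^esub> z =
      x \<otimes>\<^bsub>quaternion_ring R\<^esub> z \<oplus>\<^bsub>quaternion_ring R\<^esub> y \<otimes>\<^bsub>quaternion_ring R\<^esub> z"
    and "z \<otimes>\<^bsub>quaternion_ring R\<^esub> (x \<oplus>\<^bsub>quaternion_ring R\<^esub> y) =
      z \<otimes>\<^bsub>quaternion_ring R\<^esub> x \<oplus>\<^bsub>quaternion_ring R\<^esub> z \<otimes>\<^bsub>quaternion_ring R\<^esub> y"
    using quat_distr[of x y z] by (auto simp only: quaternion_ring_simps(2,3))
qed

lemma (in cring) quaternion_ring_relations:
  defines "H \<equiv> quaternion_ring R"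
    and "qi \<equiv> (\<zero>, \<one>, \<zero>, \<zero>)" and "qj \<equiv> (\<zero>, \<zero>, \<one>, \<zero>)" and "qk \<equiv> (\<zero>, \<zero>, \<zero>, \<one>)"
    and "scal \<equiv> \<lambda>a. (a, \<zero>, \<zero>, \<zero>)"
  shows "qi \<otimes>\<^bsub>H\<^esub> qi \<oplus>\<^bsub>H\<^esub> \<one>\<^bsub>H\<^esub> = \<zero>\<^bsub>H\<^esub>" "qj \<otimes>\<^bsub>H\<^esub> qj \<oplus>\<^bsub>H\<^esub> \<one>\<^bsub>H\<^esub> = \<zero>\<^bsub>H\<^esub>"
    "qk \<otimes>\<^bsub>H\<^esub> qk \<oplus>\<^bsub>H\<^esub> \<one>\<^bsub>H\<^esub> = \<zero>\<^bsub>H\<^esub>"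
    "qi \<otimes>\<^bsub>H\<^esub> qj = qk" "qj \<otimes>\<^bsub>H\<^esub> qi \<oplus>\<^bsub>H\<^esub> qk = \<zero>\<^bsub>H\<^esub>"
    "qj \<otimes>\<^bsub>H\<^esub> qk = qi" "qk \<otimes>\<^bsub>H\<^esub> qj \<oplus>\<^bsub>H\<^esub> qi = \<zero>\<^bsub>H\<^esub>"
    "qk \<otimes>\<^bsub>H\<^esub> qi = qj" "qi \<otimes>\<^bsub>H\<^esub> qk \<oplus>\<^bsub>H\<^esub> qj = \<zero>\<^bsub>H\<^esub>"
    "\<And>a x. a \<in> carrier R \<Longrightarrow> x \<in> {qi, qj, qk} \<Longrightarrow> scal a \<otimes>\<^bsub>H\<^esub> x = x \<otimes>\<^bsub>H\<^esub> scal a"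
    "\<And>a b c d. a \<in> carrier R \<Longrightarrow> b \<in> carrier R \<Longrightarrow> c \<in> carrier R \<Longrightarrow> d \<in> carrier R \<Longrightarrow>
       (a, b, c, d) = scal a \<oplus>\<^bsub>H\<^esub> scal b \<otimes>\<^bsub>H\<^esub> qi \<oplus>\<^bsub>H\<^esub> scal c \<otimes>\<^bsub>H\<^esub> qj \<oplus>\<^bsub>H\<^esub> scal d \<otimes>\<^bsub>H\<^esub> qk"
  unfolding assms by (auto simp: quaternion_ring_simps minus_eq l_neg)

text \<open>
  Left or right zero-divisors; \<open>\<zero>\<close> is a zero-divisor of every nontrivial ring.  In a finite ring
  the left/right distinction is immaterial, see \<open>zero_divisor_iff_two_sided\<close>.
\<close>

definition zero_divisor :: "('a, 'm) ring_scheme \<Rightarrow> 'a \<Rightarrow> bool" where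
  "zero_divisor R a \<longleftrightarrow> a \<in> carrier R \<and>
     (\<exists>b\<in>carrier R. b \<noteq> \<zero>\<^bsub>R\<^esub> \<and> (a \<otimes>\<^bsub>R\<^esub> b = \<zero>\<^bsub>R\<^esub> \<or> b \<otimes>\<^bsub>R\<^esub> a = \<zero>\<^bsub>R\<^esub>))"

lemma (in ring) zero_divisor_iff_two_sided:
  assumes fin: "finite (carrier R)"
  shows "zero_divisor R a \<longleftrightarrow> a \<in> carrier R \<and>
     (\<exists>b\<in>carrier R. b \<noteq> \<zero> \<and> a \<otimes> b = \<zero>) \<and> (\<exists>b\<in>carrier R. b \<noteq> \<zero> \<and> b \<otimes> a = \<zero>)"
proof -
  have right: "\<exists>c\<in>carrier R. c \<noteq> \<zero> \<and> c \<otimes> a = \<zero>"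
    if a: "a \<in> carrier R" and b: "b \<in> carrier R" "b \<noteq> \<zero>" "a \<otimes> b = \<zero>" for b
  proof (rule ccontr)
    assume none: "\<not> ?thesis"
    have "inj_on (\<lambda>x. x \<otimes> a) (carrier R)"
    proof (rule inj_onI)
      fix x y assume xy: "x \<in> carrier R" "y \<in> carrier R" "x \<otimes> a = y \<otimes> a"
      then have "(x \<ominus> y) \<otimes> a = \<zero>" using a by algebra
      then have "x \<ominus> y = \<zero>" using none xy by blast
      then show "x = y" using xy by simp
    qed
    then have "(\<lambda>x. x \<otimes> a) ` carrier R = carrier R"
      using fin a by (intro endo_inj_surj) auto
    then obtain c where c: "c \<in> carrier R" "c \<otimes> a = \<one>" by (metis imageE one_closed)
    have "b = (c \<otimes> a) \<otimes> b" using b c by simp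
    also have "\<dots> = c \<otimes> (a \<otimes> b)" using a b c by (intro m_assoc)
    also have "\<dots> = \<zero>" using b c by simp
    finally show False using b by simp
  qed
  have left: "\<exists>c\<in>carrier R. c \<noteq> \<zero> \<and> a \<otimes> c = \<zero>"
    if a: "a \<in> carrier R" and b: "b \<in> carrier R" "b \<noteq> \<zero>" "b \<otimes> a = \<zero>" for b
  proof (rule ccontr)
    assume none: "\<not> ?thesis"
    have "inj_on (\<lambda>x. a \<otimes> x) (carrier R)"
    proof (rule inj_onI)
      fix x y assume xy: "x \<in> carrier R" "y \<in> carrier R" "a \<otimes> x = a \<otimes> y"
      then have "a \<otimes> (x \<ominus> y) = \<zero>" using a by algebra
      then have "x \<ominus> y = \<zero>" using none xy by blast
      then show "x = y" using xy by simp
    qed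
    then have "(\<lambda>x. a \<otimes> x) ` carrier R = carrier R"
      using fin a by (intro endo_inj_surj) auto
    then obtain c where c: "c \<in> carrier R" "a \<otimes> c = \<one>" by (metis imageE one_closed)
    have "b = b \<otimes> (a \<otimes> c)" using b c by simp
    also have "\<dots> = (b \<otimes> a) \<otimes> c" using a b c by (intro m_assoc[symmetric])
    also have "\<dots> = \<zero>" using b c by simp
    finally show False using b by simp
  qed
  show ?thesis unfolding zero_divisor_def using left right by blast
qed

fun coords :: "'a quat \<Rightarrow> 'a list" where
  "coords (a1, a2, a3, a4) = [a1, a2, a3, a4]"

definition num_units :: "('a, 'm) ring_scheme \<Rightarrow> 'a quat \<Rightarrow> nat" where
  "num_units R x = length (filter (\<lambda>a. a \<in> Units R) (coords x))"

definition num_zero_divisors :: "('a, 'm) ring_scheme \<Rightarrow> 'a quat \<Rightarrow> nat" where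
  "num_zero_divisors R x = length (filter (zero_divisor R) (coords x))"

datatype quat_case = Case_i | Case_ii | Case_iii | Case_iv | Case_v

fun in_case :: "('a, 'm) ring_scheme \<Rightarrow> 'a quat \<Rightarrow> quat_case \<Rightarrow> bool" where
  "in_case R x Case_i \<longleftrightarrow> (\<forall>a\<in>set (coords x). zero_divisor R a)"
| "in_case R x Case_ii \<longleftrightarrow> (\<forall>a\<in>set (coords x). a \<in> Units R)"
| "in_case R x Case_iii \<longleftrightarrow> num_units R x = 2 \<and> num_zero_divisors R x = 2"
| "in_case R x Case_iv \<longleftrightarrow> num_units R x = 3 \<and> num_zero_divisors R x = 1"
| "in_case R x Case_v \<longleftrightarrow> num_units R x = 1 \<and> num_zero_divisors R x = 3"

end

theory Submission
  imports Defs
begin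

text \<open>
  Conjugation reverses products and scalars are central, so the norm \<open>N x = x * conj x\<close> is
  multiplicative and a quaternion over a commutative ring is a unit iff its norm is.  In a finite
  ring the zero-divisors are exactly the non-units.  Over the integers modulo \<open>2\<^sup>n\<close> everything
  therefore depends on the parity of \<open>a\<^sub>1\<^sup>2 + a\<^sub>2\<^sup>2 + a\<^sub>3\<^sup>2 + a\<^sub>4\<^sup>2\<close>, which is the parity of the
  number of unit coordinates.
\<close>

lemma (in ring) unit_not_zero_divisor:
  assumes "a \<in> Units R"
  shows "\<not> zero_divisor R a"
proof
  assume "zero_divisor R a"
  then obtain b where b: "b \<in> carrier R" "b \<noteq> \<zero>" "a \<otimes> b = \<zero> \<or> b \<otimes> a = \<zero>"
    by (auto simp: zero_divisor_def)
  have "inv a \<otimes> (a \<otimes> b) = b"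
    using assms b(1) by (simp add: Units_closed flip: m_assoc)
  moreover have "(b \<otimes> a) \<otimes> inv a = b"
    using assms b(1) by (simp add: Units_closed m_assoc)
  ultimately show False
    using assms b by (metis Units_inv_closed l_null r_null)
qed

lemma (in ring) finite_zero_divisor_or_unit:
  assumes "finite (carrier R)" and a: "a \<in> carrier R" and nzd: "\<not> zero_divisor R a"
  shows "a \<in> Units R"
proof -
  have cancel: "b = \<zero>" if "b \<in> carrier R" "a \<otimes> b = \<zero>" for b
    using that a nzd by (auto simp: zero_divisor_def)
  have "inj_on (\<lambda>b. a \<otimes> b) (carrier R)"
  proof (rule inj_onI)
    fix b c assume bc: "b \<in> carrier R" "c \<in> carrier R" "a \<otimes> b = a \<otimes> c"
    then have "a \<otimes> (b \<ominus> c) = \<zero>"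
      using a by algebra
    then have "b \<ominus> c = \<zero>"
      by (rule cancel[rotated]) (use bc in simp)
    then show "b = c"
      using bc by simp
  qed
  then have "(\<lambda>b. a \<otimes> b) ` carrier R = carrier R"
    using assms by (intro endo_inj_surj) auto
  then obtain b where b: "b \<in> carrier R" "a \<otimes> b = \<one>"
    by (metis imageE one_closed)
  have "a \<otimes> (b \<otimes> a) = a"
    using a b by (simp flip: m_assoc)
  then have "a \<otimes> (b \<otimes> a \<ominus> \<one>) = \<zero>"
    using a b by (simp add: minus_eq r_distr r_minus r_neg)
  then have "b \<otimes> a \<ominus> \<one> = \<zero>"
    by (rule cancel[rotated]) (use a b in simp)
  then have "b \<otimes> a = \<one>"
    using a b by simp
  then show ?thesis
    using a b by (auto simp: Units_def)
qed

lemma (in ring) finite_zero_divisor_iff_not_unit: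
  assumes "finite (carrier R)" "a \<in> carrier R"
  shows "zero_divisor R a \<longleftrightarrow> a \<notin> Units R"
  using assms finite_zero_divisor_or_unit unit_not_zero_divisor by blast

fun quat_conj :: "('a, 'm) ring_scheme \<Rightarrow> 'a quat \<Rightarrow> 'a quat" where
  "quat_conj R (a1, a2, a3, a4) = (a1, \<ominus>\<^bsub>R\<^esub> a2, \<ominus>\<^bsub>R\<^esub> a3, \<ominus>\<^bsub>R\<^esub> a4)"

fun quat_norm :: "('a, 'm) ring_scheme \<Rightarrow> 'a quat \<Rightarrow> 'a" where
  "quat_norm R (a1, a2, a3, a4) =
     a1 \<otimes>\<^bsub>R\<^esub> a1 \<oplus>\<^bsub>R\<^esub> a2 \<otimes>\<^bsub>R\<^esub> a2 \<oplus>\<^bsub>R\<^esub> a3 \<otimes>\<^bsub>R\<^esub> a3 \<oplus>\<^bsub>R\<^esub> a4 \<otimes>\<^bsub>R\<^esub> a4"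

definition quat_of_scalar :: "('a, 'm) ring_scheme \<Rightarrow> 'a \<Rightarrow> 'a quat" where
  "quat_of_scalar R a = (a, \<zero>\<^bsub>R\<^esub>, \<zero>\<^bsub>R\<^esub>, \<zero>\<^bsub>R\<^esub>)"

context cring
begin

abbreviation quaternions ("\<H>") where
  "\<H> \<equiv> quaternion_ring R"

interpretation quat: ring \<H>
  by (rule quaternion_ring_is_ring)

lemma quat_one_eq_scalar: "\<one>\<^bsub>\<H>\<^esub> = quat_of_scalar R \<one>"
  by (simp add: quaternion_ring_simps quat_of_scalar_def)

lemma quat_of_scalar_closed: "a \<in> carrier R \<Longrightarrow> quat_of_scalar R a \<in> carrier \<H>"
  by (simp add: quaternion_ring_simps quat_of_scalar_def)

lemma quat_of_scalar_mult:
  "a \<in> carrier R \<Longrightarrow> b \<in> carrier R \<Longrightarrow>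
    quat_of_scalar R (a \<otimes> b) = quat_of_scalar R a \<otimes>\<^bsub>\<H>\<^esub> quat_of_scalar R b"
  by (simp add: quaternion_ring_simps quat_of_scalar_def minus_eq)

lemma quat_of_scalar_left_commute:
  assumes "a \<in> carrier R" "x \<in> carrier \<H>" "y \<in> carrier \<H>"
  shows "x \<otimes>\<^bsub>\<H>\<^esub> (quat_of_scalar R a \<otimes>\<^bsub>\<H>\<^esub> y) = quat_of_scalar R a \<otimes>\<^bsub>\<H>\<^esub> (x \<otimes>\<^bsub>\<H>\<^esub> y)"
proof -
  have "x \<otimes>\<^bsub>\<H>\<^esub> quat_of_scalar R a = quat_of_scalar R a \<otimes>\<^bsub>\<H>\<^esub> x"
    using assms by (auto simp: quaternion_ring_simps quat_of_scalar_def minus_eq m_comm)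
  then show ?thesis
    using assms by (simp add: quat_of_scalar_closed flip: quat.m_assoc)
qed

lemma quat_conj_closed: "x \<in> carrier \<H> \<Longrightarrow> quat_conj R x \<in> carrier \<H>"
  by (auto simp: quaternion_ring_simps)

lemma quat_norm_closed: "x \<in> carrier \<H> \<Longrightarrow> quat_norm R x \<in> carrier R"
  by (auto simp: quaternion_ring_simps)

lemma quat_norm_one: "quat_norm R \<one>\<^bsub>\<H>\<^esub> = \<one>"
  by (simp add: quaternion_ring_simps)

lemma quat_conj_mult:
  "x \<in> carrier \<H> \<Longrightarrow> y \<in> carrier \<H> \<Longrightarrow>
    quat_conj R (x \<otimes>\<^bsub>\<H>\<^esub> y) = quat_conj R y \<otimes>\<^bsub>\<H>\<^esub> quat_conj R x"
  by (auto simp: quaternion_ring_simps minus_eq minus_add l_minus r_minus m_comm a_ac)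

lemma quat_mult_conj:
  assumes "x \<in> carrier \<H>"
  shows "x \<otimes>\<^bsub>\<H>\<^esub> quat_conj R x = quat_of_scalar R (quat_norm R x)"
    and "quat_conj R x \<otimes>\<^bsub>\<H>\<^esub> x = quat_of_scalar R (quat_norm R x)"
proof -
  have "p \<oplus> (q \<oplus> (\<ominus> p \<oplus> \<ominus> q)) = \<zero>" if "p \<in> carrier R" "q \<in> carrier R" for p q
    using that by algebra
  with assms show "x \<otimes>\<^bsub>\<H>\<^esub> quat_conj R x = quat_of_scalar R (quat_norm R x)"
    and "quat_conj R x \<otimes>\<^bsub>\<H>\<^esub> x = quat_of_scalar R (quat_norm R x)"
    by (auto simp: quaternion_ring_simps quat_of_scalar_def minus_eq l_minus r_minus m_comm a_ac
        r_neg r_neg1 r_neg2)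
qed

lemma quat_norm_mult:
  assumes x: "x \<in> carrier \<H>" and y: "y \<in> carrier \<H>"
  shows "quat_norm R (x \<otimes>\<^bsub>\<H>\<^esub> y) = quat_norm R x \<otimes> quat_norm R y"
proof -
  let ?s = "quat_of_scalar R" and ?N = "quat_norm R" and ?c = "quat_conj R"
  note closed = x y quat_conj_closed quat_norm_closed quat_of_scalar_closed
  have "?s (?N (x \<otimes>\<^bsub>\<H>\<^esub> y)) = (x \<otimes>\<^bsub>\<H>\<^esub> y) \<otimes>\<^bsub>\<H>\<^esub> (?c y \<otimes>\<^bsub>\<H>\<^esub> ?c x)"
    using x y by (simp add: quat_mult_conj flip: quat_conj_mult)
  also have "\<dots> = x \<otimes>\<^bsub>\<H>\<^esub> ((y \<otimes>\<^bsub>\<H>\<^esub> ?c y) \<otimes>\<^bsub>\<H>\<^esub> ?c x)"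
    by (simp add: closed quat.m_assoc)
  also have "\<dots> = ?s (?N y) \<otimes>\<^bsub>\<H>\<^esub> ?s (?N x)"
    by (simp add: closed quat_mult_conj quat_of_scalar_left_commute)
  also have "\<dots> = ?s (?N x \<otimes> ?N y)"
    by (simp add: closed m_comm flip: quat_of_scalar_mult)
  finally show ?thesis
    by (simp add: quat_of_scalar_def)
qed

theorem quat_unit_iff_norm_unit:
  assumes x: "x \<in> carrier \<H>"
  shows "x \<in> Units \<H> \<longleftrightarrow> quat_norm R x \<in> Units R"
proof
  assume "x \<in> Units \<H>"
  then obtain y where y: "y \<in> carrier \<H>" "x \<otimes>\<^bsub>\<H>\<^esub> y = \<one>\<^bsub>\<H>\<^esub>"
    using quat.Units_r_inv_ex by blast
  then have "quat_norm R x \<otimes> quat_norm R y = \<one>"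
    using x quat_norm_one by (simp flip: quat_norm_mult)
  moreover have "quat_norm R x \<in> carrier R" "quat_norm R y \<in> carrier R"
    using x y quat_norm_closed by auto
  ultimately show "quat_norm R x \<in> Units R"
    using m_comm unfolding Units_def by fastforce
next
  assume N: "quat_norm R x \<in> Units R"
  let ?s = "quat_of_scalar R (inv (quat_norm R x))"
  have s: "?s \<in> carrier \<H>"
    using N by (simp add: quat_of_scalar_closed)
  have unit: "?s \<otimes>\<^bsub>\<H>\<^esub> quat_of_scalar R (quat_norm R x) = \<one>\<^bsub>\<H>\<^esub>"
    using N by (simp add: quat_one_eq_scalar Units_closed flip: quat_of_scalar_mult)
  have "x \<otimes>\<^bsub>\<H>\<^esub> (?s \<otimes>\<^bsub>\<H>\<^esub> quat_conj R x) = \<one>\<^bsub>\<H>\<^esub>"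
    using x N unit by (simp add: quat_of_scalar_left_commute quat_conj_closed quat_mult_conj)
  moreover have "(?s \<otimes>\<^bsub>\<H>\<^esub> quat_conj R x) \<otimes>\<^bsub>\<H>\<^esub> x = \<one>\<^bsub>\<H>\<^esub>"
    using x s unit by (simp add: quat_conj_closed quat_mult_conj quat.m_assoc)
  ultimately show "x \<in> Units \<H>"
    using x s by (auto simp: Units_def quat_conj_closed)
qed

lemma finite_quat_zero_divisor_iff_not_unit:
  assumes "finite (carrier R)" "x \<in> carrier \<H>"
  shows "zero_divisor \<H> x \<longleftrightarrow> x \<notin> Units \<H>"
  using assms
  by (intro quat.finite_zero_divisor_iff_not_unit) (simp_all add: quaternion_ring_simps(1))

end

fun num_units_of_case :: "quat_case \<Rightarrow> nat" where
  "num_units_of_case Case_i = 0"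
| "num_units_of_case Case_ii = 4"
| "num_units_of_case Case_iii = 2"
| "num_units_of_case Case_iv = 3"
| "num_units_of_case Case_v = 1"

lemma ex1_num_units_of_case:
  assumes "k \<le> 4"
  shows "\<exists>!c. num_units_of_case c = k"
proof (rule ex_ex1I)
  have "k \<in> {0, 1, 2, 3, 4}"
    using assms by auto
  then show "\<exists>c. num_units_of_case c = k"
    by (metis empty_iff insert_iff num_units_of_case.simps)
  show "c = d" if "num_units_of_case c = k" "num_units_of_case d = k" for c d
    using that by (cases c; cases d) simp_all
qed

lemma num_units_le_4: "num_units R x \<le> 4"
  by (cases x) (simp add: num_units_def)

context ring
begin

lemma finite_in_case_iff_num_units:
  assumes "finite (carrier R)" "x \<in> carrier (quaternion_ring R)"
  shows "in_case R x c \<longleftrightarrow> num_units R x = num_units_of_case c"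
proof -
  have "zero_divisor R a \<longleftrightarrow> a \<notin> Units R" if "a \<in> set (coords x)" for a
    using assms that finite_zero_divisor_iff_not_unit
    by (cases x) (auto simp: quaternion_ring_simps)
  then show ?thesis
    by (cases x; cases c) (auto simp: num_units_def num_zero_divisors_def)
qed

lemma finite_ex1_in_case:
  assumes "finite (carrier R)" "x \<in> carrier (quaternion_ring R)"
  shows "\<exists>!c. in_case R x c"
  using assms ex1_num_units_of_case[OF num_units_le_4, of R x]
  by (simp add: finite_in_case_iff_num_units eq_commute)

end

context residues
begin

lemma res_mod_unit_iff_coprime: "a mod m \<in> Units R \<longleftrightarrow> coprime a m"
proof
  show "coprime a m" if "a mod m \<in> Units R"
    using that m_gt_one by (simp add: res_units_eq)
  show "a mod m \<in> Units R" if "coprime a m"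
    using m_gt_one that by (rule mod_in_res_units)
qed

lemma res_unit_iff_coprime: "a \<in> carrier R \<Longrightarrow> a \<in> Units R \<longleftrightarrow> coprime a m"
  using res_mod_unit_iff_coprime[of a] by (simp add: res_carrier_eq)

lemma res_quat_norm_eq: "quat_norm R (a1, a2, a3, a4) = (a1\<^sup>2 + a2\<^sup>2 + a3\<^sup>2 + a4\<^sup>2) mod m"
  by (simp add: res_add_eq res_mult_eq power2_eq_square mod_simps)

lemma res_quat_unit_iff_coprime:
  "(a1, a2, a3, a4) \<in> carrier \<H> \<Longrightarrow>
    (a1, a2, a3, a4) \<in> Units \<H> \<longleftrightarrow> coprime (a1\<^sup>2 + a2\<^sup>2 + a3\<^sup>2 + a4\<^sup>2) m"
  by (simp only: quat_unit_iff_norm_unit res_quat_norm_eq res_mod_unit_iff_coprime)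

lemma two_power_coprime_iff_odd: "m = 2 ^ n \<Longrightarrow> coprime a m \<longleftrightarrow> odd a"
  using m_gt_one by (cases n) auto

lemma two_power_unit_iff_odd:
  "m = 2 ^ n \<Longrightarrow> a \<in> carrier R \<Longrightarrow> a \<in> Units R \<longleftrightarrow> odd a"
  using res_unit_iff_coprime two_power_coprime_iff_odd by blast

lemma two_power_quat_unit_iff_odd_num_units:
  assumes m: "m = 2 ^ n" and x: "x \<in> carrier \<H>"
  shows "x \<in> Units \<H> \<longleftrightarrow> odd (num_units R x)"
proof -
  obtain a1 a2 a3 a4 where x_eq: "x = (a1, a2, a3, a4)"
    by (metis prod_cases4)
  have "a \<in> Units R \<longleftrightarrow> odd a" if "a \<in> {a1, a2, a3, a4}" for a
    using that x two_power_unit_iff_odd[OF m] by (auto simp: x_eq quaternion_ring_simps)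
  then have "odd (num_units R x) \<longleftrightarrow> odd (a1\<^sup>2 + a2\<^sup>2 + a3\<^sup>2 + a4\<^sup>2)"
    by (auto simp: x_eq num_units_def)
  with x show ?thesis
    by (simp only: x_eq res_quat_unit_iff_coprime two_power_coprime_iff_odd[OF m])
qed

end

theorem theorem3p1:
  fixes n :: nat and a1 a2 a3 a4 :: int
  assumes "n \<ge> 1"
    and "(a1, a2, a3, a4) \<in> carrier (quaternion_ring (residue_ring (2 ^ n)))"
  shows "
    (\<forall>a\<in>{a1, a2, a3, a4}.
           (a \<in> Units (residue_ring (2 ^ n)) \<longleftrightarrow> odd a) \<and>
           (zero_divisor (residue_ring (2 ^ n)) a \<longleftrightarrow> even a)) \<and>
    (\<exists>!c. in_case (residue_ring (2 ^ n)) (a1, a2, a3, a4) c) \<and>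
    (\<forall>c\<in>{Case_i, Case_ii, Case_iii}.
           in_case (residue_ring (2 ^ n)) (a1, a2, a3, a4) c \<longrightarrow>
           zero_divisor (quaternion_ring (residue_ring (2 ^ n))) (a1, a2, a3, a4)) \<and>
    (\<forall>c\<in>{Case_iv, Case_v}.
           in_case (residue_ring (2 ^ n)) (a1, a2, a3, a4) c \<longrightarrow>
           (a1, a2, a3, a4) \<in> Units (quaternion_ring (residue_ring (2 ^ n))))"
proof -
  let ?R = "residue_ring (2 ^ n)" and ?x = "(a1, a2, a3, a4)"
  let ?H = "quaternion_ring ?R"
  interpret residues "2 ^ n" ?R
    using assms(1) by unfold_locales simp_all
  have "a \<in> carrier ?R" if "a \<in> {a1, a2, a3, a4}" for a
    using that assms(2) by (auto simp: quaternion_ring_simps)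
  then have coordinates:
    "\<forall>a\<in>{a1, a2, a3, a4}. (a \<in> Units ?R \<longleftrightarrow> odd a) \<and> (zero_divisor ?R a \<longleftrightarrow> even a)"
    using two_power_unit_iff_odd[OF refl] finite_zero_divisor_iff_not_unit[OF finite] by blast
  have unit_iff: "?x \<in> Units ?H \<longleftrightarrow> odd (num_units_of_case c)" if "in_case ?R ?x c" for c
    using that assms(2) two_power_quat_unit_iff_odd_num_units finite_in_case_iff_num_units by simp
  have zero_divisor_iff: "zero_divisor ?H ?x \<longleftrightarrow> ?x \<notin> Units ?H"
    using assms(2) by (rule finite_quat_zero_divisor_iff_not_unit[OF finite])
  have "\<exists>!c. in_case ?R ?x c"
    using assms(2) by (rule finite_ex1_in_case[OF finite])
  with coordinates show ?thesis
    by (simp add: unit_iff zero_divisor_iff del: in_case.simps)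
qed

end
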